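(* Let $P$ be a poset with no infinite antichain and $\alpha$ a countable ordinal. Then $AM_2(P)$ is $\alpha$-bqo if and only if $\bigcup AM_2(P)$ is $\alpha$-bqo.
   Context: $AM_2(P)$ is the set of maximal antichains of $P$ having exactly two elements, ordered by domination: $X\leq Y$ iff for every $x\in X$ there is $y\in Y$ with $x\leq y$. $\bigcup AM_2(P)$ is the union of all these antichains, with the order induced from $P$. Barriers and $\alpha$-bqo: finite subsets of $\mathbb{N}$ are identified with their increasing enumerations. For finite $s,t\subseteq\mathbb{N}$ write $s\triangleleft t$ if there is a finite $r\subseteq\mathbb{N}$ such that $s$ is a proper initial segment of $r$ and $t$ is $r$ with its least element removed. A barrier is an infinite set $B$ of finite subsets of $\mathbb{N}$, no member of which is a proper subset of another, such that every infinite $X\subseteq\bigcup B$ has a nonempty initial segment belonging to $B$. A barrier is well-ordered by the lexicographic order; its order type is the type of this well-order. A map $f$ from a barrier $B$ into a quasi-ordered set $Q$ is good if there exist $s,t\in B$ with $s\triangleleft t$ and $f(s)\leq f(t)$, and bad otherwise. $Q$ is $\alpha$-bqo if every map from a barrier of order type at most $\alpha$ into $Q$ is good. *)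

theory Defs
  imports Main "HOL-Library.Countable_Set"
begin

definition antichain :: "'a set \<Rightarrow> 'a rel \<Rightarrow> 'a set \<Rightarrow> bool" where
  "antichain P r A \<longleftrightarrow> A \<subseteq> P \<and> (\<forall>x\<in>A. \<forall>y\<in>A. x \<noteq> y \<longrightarrow> (x, y) \<notin> r)"

definition maximal_antichain :: "'a set \<Rightarrow> 'a rel \<Rightarrow> 'a set \<Rightarrow> bool" where
  "maximal_antichain P r A \<longleftrightarrow> antichain P r A \<and>
     (\<forall>B. antichain P r B \<and> A \<subseteq> B \<longrightarrow> B = A)"

definition AM2 :: "'a set \<Rightarrow> 'a rel \<Rightarrow> 'a set set" where
  "AM2 P r = {A. maximal_antichain P r A \<and> card A = 2}"

definition AM2_rel :: "'a set \<Rightarrow> 'a rel \<Rightarrow> 'a set rel" where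
  "AM2_rel P r = {(X, Y). X \<in> AM2 P r \<and> Y \<in> AM2 P r \<and> (\<forall>x\<in>X. \<exists>y\<in>Y. (x, y) \<in> r)}"

definition UAM2_rel :: "'a set \<Rightarrow> 'a rel \<Rightarrow> 'a rel" where
  "UAM2_rel P r = r \<inter> (\<Union>(AM2 P r) \<times> \<Union>(AM2 P r))"

definition initial_segment :: "nat set \<Rightarrow> nat set \<Rightarrow> bool" where
  "initial_segment s X \<longleftrightarrow> s \<subseteq> X \<and> (\<forall>x\<in>s. \<forall>y\<in>X. y < x \<longrightarrow> y \<in> s)"

definition shift_rel :: "nat set \<Rightarrow> nat set \<Rightarrow> bool" where
  "shift_rel s t \<longleftrightarrow> (\<exists>r. finite r \<and> r \<noteq> {} \<and> initial_segment s r \<and> s \<noteq> r \<and> t = r - {Min r})"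

definition barrier :: "nat set set \<Rightarrow> bool" where
  "barrier B \<longleftrightarrow> infinite B \<and> (\<forall>s\<in>B. finite s) \<and>
     (\<forall>s\<in>B. \<forall>t\<in>B. \<not> s \<subset> t) \<and>
     (\<forall>X. X \<subseteq> \<Union>B \<and> infinite X \<longrightarrow>
        (\<exists>s\<in>B. s \<noteq> {} \<and> finite s \<and> initial_segment s X))"

definition lex_rel :: "nat set set \<Rightarrow> nat set rel" where
  "lex_rel B = {(s, t). s \<in> B \<and> t \<in> B \<and>
     (s = t \<or> (sorted_list_of_set s, sorted_list_of_set t) \<in> lexord {(x, y). x < y})}"

definition good_map :: "nat set set \<Rightarrow> 'q rel \<Rightarrow> (nat set \<Rightarrow> 'q) \<Rightarrow> bool" where
  "good_map B R f \<longleftrightarrow> (\<exists>s\<in>B. \<exists>t\<in>B. shift_rel s t \<and> (f s, f t) \<in> R)"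

definition alpha_bqo :: "'b rel \<Rightarrow> 'q set \<Rightarrow> 'q rel \<Rightarrow> bool" where
  "alpha_bqo \<alpha> Q R \<longleftrightarrow> (\<forall>B f. barrier B \<and> (lex_rel B, \<alpha>) \<in> ordLeq \<and> f ` B \<subseteq> Q
      \<longrightarrow> good_map B R f)"

end

theory Submission
  imports Defs
begin

text \<open>
  By a clopen Ramsey argument, every two-colouring of the pairs \<open>s \<triangleleft> t\<close> of a barrier is constant on a
  sub-barrier, and sub-barriers have smaller or equal order type. If \<open>\<Union>AM2\<close> is bqo, homogenising
  one coordinate of \<open>F s = {f s, g s}\<close> and then applying the hypothesis to the other one shows that
  \<open>F\<close> is good.

  Conversely, let \<open>f\<close> be a bad map into \<open>\<Union>AM2\<close>, choose \<open>g\<close> with \<open>{f s, g s} \<in> AM2\<close>, and homogenise so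
  that \<open>{f s, g s}\<close> is dominated by \<open>{f t, g t}\<close> whenever \<open>s \<triangleleft> t\<close>. Domination and maximality force
  \<open>f s \<le> g t\<close> and \<open>g s \<le> f t\<close>, so, following \<open>\<triangleleft>\<close>-paths of both parities, all of \<open>{f s, g s}\<close> lies
  below all of \<open>{f t, g t}\<close> once \<open>t\<close> is far beyond \<open>s\<close>. If \<open>v \<triangleleft> w\<close> and \<open>{f t, g t}\<close> lies below
  \<open>f w\<close>, then \<open>f v\<close> is below neither element of \<open>{f t, g t}\<close>, hence above one of them by maximality.
  This transfers lower bounds backwards along \<open>\<triangleleft>\<close>, until \<open>f s \<le> f v\<close> for some \<open>s \<triangleleft> v\<close>.
\<close>

unbundle cardinal_syntax

section \<open>Ramsey's theorem for clopen colourings of infinite sets\<close>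

definition precedes :: "nat set \<Rightarrow> nat set \<Rightarrow> bool" where
  "precedes a Y \<longleftrightarrow> (\<forall>x\<in>a. \<forall>y\<in>Y. x < y)"

text \<open>For finite \<open>a\<close>, the sets \<open>a \<union> Z\<close> considered here form
  the Ellentuck neighbourhood of \<open>a\<close> in \<open>Y\<close>.\<close>

definition homogeneous :: "(nat set \<Rightarrow> bool) \<Rightarrow> nat set \<Rightarrow> nat set \<Rightarrow> bool" where
  "homogeneous C a Y \<longleftrightarrow> (\<exists>c. \<forall>Z. Z \<subseteq> Y \<and> infinite Z \<and> precedes a Z \<longrightarrow> C (a \<union> Z) = c)"

lemma infinite_nat_greater:
  fixes X :: "nat set"
  assumes "infinite X"
  shows "infinite (X \<inter> {n<..})"
proof -
  have "X = (X \<inter> {n<..}) \<union> (X \<inter> {..n})" by auto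
  then show ?thesis using assms by (metis finite_Int finite_UnI finite_atMost)
qed

text \<open>A fusion argument: thin \<open>U\<close> so that each point \<open>n i\<close> of a
  sequence has \<open>insert (n i) a\<close> decided on what follows, then keep infinitely many
  points of one common colour. The least element of any remaining \<open>Z\<close> then fixes its
  colour.\<close>

lemma homogeneous_extend:
  assumes U: "infinite U" and a: "finite a"
    and step: "\<And>n X. n \<in> U \<Longrightarrow> precedes a {n} \<Longrightarrow> X \<subseteq> U \<Longrightarrow> infinite X \<Longrightarrow>
      \<exists>Y\<subseteq>X. infinite Y \<and> homogeneous C (insert n a) Y"
  shows "\<exists>Y\<subseteq>U. infinite Y \<and> homogeneous C a Y"
proof -
  obtain k where k: "\<And>x. x \<in> a \<Longrightarrow> x \<le> k"
    using a finite_nat_set_iff_bounded_le by auto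
  define X0 where "X0 = U \<inter> {k<..}"
  have X0: "X0 \<subseteq> U" "infinite X0" "precedes a X0"
    using infinite_nat_greater[OF U] by (auto simp: X0_def precedes_def dest: k)
  \<comment> \<open>One fusion step: split off the least element and thin the rest. The implication
    makes the statement total, so that a choice function \<open>G\<close> can be extracted.\<close>
  have "\<exists>Y. X \<subseteq> X0 \<and> infinite X \<longrightarrow>
      Y \<subseteq> X \<inter> {Inf X<..} \<and> infinite Y \<and> homogeneous C (insert (Inf X) a) Y" for X
  proof (cases "X \<subseteq> X0 \<and> infinite X")
    case True
    then have "Inf X \<in> X" by (metis Inf_nat_def1 finite.emptyI)
    then have "Inf X \<in> U" "precedes a {Inf X}" using True X0 by (auto simp: precedes_def)
    with step[of "Inf X" "X \<inter> {Inf X<..}"] infinite_nat_greater[of X "Inf X"] True X0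
    show ?thesis by blast
  qed auto
  then obtain G where G: "\<And>X. X \<subseteq> X0 \<Longrightarrow> infinite X \<Longrightarrow>
      G X \<subseteq> X \<inter> {Inf X<..} \<and> infinite (G X) \<and> homogeneous C (insert (Inf X) a) (G X)"
    by metis
  define S where "S i = (G ^^ i) X0" for i
  define n where "n i = Inf (S i)" for i
  have S: "S i \<subseteq> X0 \<and> infinite (S i)" for i
  proof (induction i)
    case (Suc i)
    with G[of "S i"] show ?case by (auto simp: S_def)
  qed (use X0 in \<open>auto simp: S_def\<close>)
  have S_Suc: "S (Suc i) \<subseteq> S i \<inter> {n i<..}" "homogeneous C (insert (n i) a) (S (Suc i))" for i
    using G[of "S i"] S[of i] by (auto simp: S_def n_def)
  have nS: "n i \<in> S i" for i
    using S[of i] unfolding n_def by (metis Inf_nat_def1 finite.emptyI)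
  have S_anti: "i \<le> j \<Longrightarrow> S j \<subseteq> S i" for i j
    by (rule lift_Suc_antimono_le[of S]) (use S_Suc in auto)
  have n_later: "n j \<in> S (Suc i)" if "i < j" for i j
    using S_anti[of "Suc i" j] nS[of j] that by auto
  have n_mono: "strict_mono n"
  proof (rule strict_monoI)
    fix i j :: nat assume "i < j"
    then show "n i < n j" using n_later[of i j] S_Suc(1)[of i] by blast
  qed
  obtain c where c: "\<And>i Z. Z \<subseteq> S (Suc i) \<Longrightarrow> infinite Z \<Longrightarrow> precedes (insert (n i) a) Z \<Longrightarrow>
      C (insert (n i) a \<union> Z) = c i"
    using S_Suc(2) unfolding homogeneous_def by metis
  obtain d where d: "infinite {i. c i = d}"
  proof -
    have "(UNIV :: nat set) = {i. c i = True} \<union> {i. c i = False}" by auto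
    then have "infinite {i. c i = True} \<or> infinite {i. c i = False}"
      by (metis finite_UnI infinite_UNIV_nat)
    then show ?thesis using that by (elim disjE)
  qed
  define Y where "Y = n ` {i. c i = d}"
  have "infinite Y"
  proof
    assume "finite Y"
    then have "finite {i. c i = d}"
      unfolding Y_def by (rule finite_imageD) (rule strict_mono_imp_inj_on[OF n_mono])
    with d show False by simp
  qed
  moreover have "Y \<subseteq> X0" using nS S by (force simp: Y_def)
  moreover have hom: "C (a \<union> Z) = d" if Z: "Z \<subseteq> Y" "infinite Z" for Z
  proof -
    have "Inf Z \<in> Z" using Z by (metis Inf_nat_def1 finite.emptyI)
    then obtain i where i: "Inf Z = n i" "c i = d" using Z by (auto simp: Y_def)
    \<comment> \<open>Points of \<open>Z\<close> beyond its least element \<open>n i\<close> have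
      later indices, so they lie in the set that decides \<open>insert (n i) a\<close>.\<close>
    have sub: "Z - {n i} \<subseteq> S (Suc i)"
    proof
      fix z assume z: "z \<in> Z - {n i}"
      then obtain j where j: "z = n j" using Z by (auto simp: Y_def)
      have "n i \<le> z" using z i by (metis DiffD1 wellorder_Inf_le1)
      then have "n i < n j" using z j by simp
      then have "i < j" using strict_mono_less[OF n_mono] by simp
      then show "z \<in> S (Suc i)" using n_later j by simp
    qed
    have "precedes (insert (n i) a) (Z - {n i})"
      using sub S_Suc(1)[of i] S[of i] X0 by (fastforce simp: precedes_def)
    with sub have "C (insert (n i) a \<union> (Z - {n i})) = d"
      using c[of "Z - {n i}" i] i Z by simp
    moreover have "insert (n i) a \<union> (Z - {n i}) = a \<union> Z"
      using i \<open>Inf Z \<in> Z\<close> by auto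
    ultimately show ?thesis by simp
  qed
  moreover have "homogeneous C a Y" unfolding homogeneous_def using hom by simp
  ultimately show ?thesis using X0(1) by (meson subset_trans)
qed

text \<open>If \<open>{}\<close> were undecided, undecided finite sets could be prolonged forever.
  But the colour near their infinite union \<open>Z\<close> depends on a finite part only, so a long
  enough stage is decided after all.\<close>

theorem clopen_Ramsey:
  fixes C :: "nat set \<Rightarrow> bool"
  assumes U: "infinite U"
    and clopen: "\<And>Z. Z \<subseteq> U \<Longrightarrow> infinite Z \<Longrightarrow>
      \<exists>n. \<forall>Z'. Z' \<subseteq> U \<and> infinite Z' \<and> Z' \<inter> {..n} = Z \<inter> {..n} \<longrightarrow> C Z' = C Z"
  obtains X c where "X \<subseteq> U" "infinite X"
    "\<And>Z. Z \<subseteq> X \<Longrightarrow> infinite Z \<Longrightarrow> C Z = c"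
proof -
  define stuck where "stuck = (\<lambda>(a, X). finite a \<and> a \<subseteq> U \<and> X \<subseteq> U \<and> infinite X \<and>
      \<not> (\<exists>Y\<subseteq>X. infinite Y \<and> homogeneous C a Y))"
  have "\<not> stuck ({}, U)"
  proof
    assume start: "stuck ({}, U)"
    have "\<exists>q. stuck p \<longrightarrow> stuck q \<and> (\<exists>n. precedes (fst p) {n} \<and> fst q = insert n (fst p))" for p
    proof (cases p)
      case (Pair a X)
      show ?thesis
      proof (cases "stuck (a, X)")
        case True
        then have X: "infinite X" "finite a" "\<not> (\<exists>Y\<subseteq>X. infinite Y \<and> homogeneous C a Y)"
          by (auto simp: stuck_def)
        \<comment> \<open>Contrapositive of \<open>homogeneous_extend\<close> on \<open>X\<close>:
          an undecided \<open>a\<close> has an undecided one-point extension.\<close>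
        have "\<not> (\<forall>n\<in>X. \<forall>X'. precedes a {n} \<longrightarrow> X' \<subseteq> X \<longrightarrow> infinite X' \<longrightarrow>
            (\<exists>Y\<subseteq>X'. infinite Y \<and> homogeneous C (insert n a) Y))"
          using homogeneous_extend[OF X(1,2), of C] X(3) by meson
        then obtain n X' where "n \<in> X" "precedes a {n}" "X' \<subseteq> X" "infinite X'"
          "\<not> (\<exists>Y\<subseteq>X'. infinite Y \<and> homogeneous C (insert n a) Y)" by blast
        with True have "stuck (insert n a, X')" by (auto simp: stuck_def)
        with \<open>precedes a {n}\<close> Pair show ?thesis by force
      qed (use Pair in auto)
    qed
    then obtain H where H: "\<And>p. stuck p \<Longrightarrow>
        stuck (H p) \<and> (\<exists>n. precedes (fst p) {n} \<and> fst (H p) = insert n (fst p))"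
      by metis
    define p where "p i = (H ^^ i) ({}, U)" for i
    define a where "a i = fst (p i)" for i
    have stuck_p: "stuck (p i)" for i
      by (induction i) (use start H in \<open>auto simp: p_def\<close>)
    have fin: "finite (a i)" "a i \<subseteq> U" for i
      using stuck_p[of i] by (auto simp: stuck_def a_def split: prod.splits)
    have "\<exists>n. precedes (a i) {n} \<and> a (Suc i) = insert n (a i)" for i
      using H[OF stuck_p[of i]] by (auto simp: a_def p_def)
    then obtain n where n: "\<And>i. precedes (a i) {n i}" "\<And>i. a (Suc i) = insert (n i) (a i)"
      by metis
    have a_mono: "i \<le> j \<Longrightarrow> a i \<subseteq> a j" for i j
      by (rule lift_Suc_mono_le[of a]) (use n in auto)
    have a_end: "x \<in> a j \<Longrightarrow> x \<notin> a i \<Longrightarrow> precedes (a i) {x}" for i j x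
    proof (induction j)
      case 0
      then show ?case using a_mono[of 0 i] by auto
    next
      case (Suc j)
      show ?case
      proof (cases "x \<in> a j")
        case False
        then have "x = n j" using Suc n by auto
        moreover have "i \<le> j" using Suc.prems a_mono[of "Suc j" i] by (meson not_less_eq_eq subsetD)
        ultimately show ?thesis using n(1)[of j] a_mono[of i j] by (auto simp: precedes_def)
      qed (use Suc in auto)
    qed
    define Z where "Z = (\<Union>i. a i)"
    have card_a: "card (a i) \<ge> i" for i
    proof (induction i)
      case (Suc i)
      have "n i \<notin> a i" using n(1)[of i] by (auto simp: precedes_def)
      then show ?case using Suc fin n(2)[of i] by simp
    qed simp
    have "infinite Z"
    proof
      assume "finite Z"
      then have "card (a (Suc (card Z))) \<le> card Z" by (intro card_mono) (auto simp: Z_def)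
      with card_a[of "Suc (card Z)"] show False by simp
    qed
    moreover have "Z \<subseteq> U" using fin by (auto simp: Z_def)
    ultimately obtain m where m: "\<And>Z'. Z' \<subseteq> U \<Longrightarrow> infinite Z' \<Longrightarrow>
        Z' \<inter> {..m} = Z \<inter> {..m} \<Longrightarrow> C Z' = C Z"
      using clopen[of Z] by meson
    \<comment> \<open>A stage reaching beyond \<open>m\<close> contains, by \<open>a_end\<close>,
      all of \<open>Z\<close> up to \<open>m\<close>, so its extensions agree with \<open>Z\<close>
      there.\<close>
    obtain i where i: "\<exists>x\<in>a i. m < x"
      using infinite_nat_greater[OF \<open>infinite Z\<close>, of m]
      by (metis (mono_tags, lifting) Int_iff UN_E Z_def all_not_in_conv finite.emptyI greaterThan_iff)
    have agree: "(a i \<union> Y) \<inter> {..m} = Z \<inter> {..m}" if "precedes (a i) Y" for Y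
    proof -
      have "Z \<inter> {..m} \<subseteq> a i"
      proof
        fix z assume z: "z \<in> Z \<inter> {..m}"
        then obtain j where "z \<in> a j" by (auto simp: Z_def)
        then show "z \<in> a i" using a_end[of z j i] i z by (force simp: precedes_def)
      qed
      moreover have "Y \<inter> {..m} = {}" using that i by (force simp: precedes_def)
      ultimately show ?thesis by (auto simp: Z_def)
    qed
    have "C (a i \<union> Y) = C Z" if "Y \<subseteq> U" "infinite Y" "precedes (a i) Y" for Y
      using m[of "a i \<union> Y"] agree that fin by auto
    moreover obtain X where X: "p i = (a i, X)" by (metis a_def prod.collapse)
    then have "X \<subseteq> U" "infinite X" and not_hom: "\<not> homogeneous C (a i) X"
      using stuck_p[of i] by (auto simp: stuck_def)
    ultimately have "C (a i \<union> Y) = C Z" if "Y \<subseteq> X" "infinite Y" "precedes (a i) Y" for Y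
      using that by simp
    then have "homogeneous C (a i) X" unfolding homogeneous_def by simp
    with not_hom show False by simp
  qed
  then obtain Y where "Y \<subseteq> U" "infinite Y" "homogeneous C {} Y"
    using U by (auto simp: stuck_def)
  then show ?thesis using that unfolding homogeneous_def precedes_def by auto
qed

section \<open>Barriers\<close>

text \<open>Otherwise \<open>r\<close> is isomorphic to a proper initial segment of its restriction,
  below some \<open>a\<close>. The isomorphism is a strictly increasing self-map of \<open>r\<close>
  sending \<open>a\<close> below itself, which well-foundedness forbids.\<close>

lemma Restr_ordLeq:
  assumes r: "Well_order r"
  shows "Restr r A \<le>o r"
proof (rule ccontr)
  let ?r' = "Restr r A"
  assume "\<not> ?r' \<le>o r"
  then have "r <o ?r'"
    using r Well_order_Restr[OF r] by (simp add: not_ordLeq_iff_ordLess)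
  then obtain a where a: "a \<in> Field ?r'" "r =o Restr ?r' (underS ?r' a)"
    using r Well_order_Restr[OF r] ordLess_iff_ordIso_Restr by metis
  then obtain h where h: "iso r (Restr ?r' (underS ?r' a)) h"
    unfolding ordIso_def by auto
  then have emb: "embed r (Restr ?r' (underS ?r' a)) h" and inj: "inj_on h (Field r)"
    by (auto simp: iso_def bij_betw_def)
  have h_mono: "(h x, h y) \<in> Restr ?r' (underS ?r' a)" if "(x, y) \<in> r" for x y
    using embed_compat[OF emb] that by (auto simp: compat_def)
  have h_lt: "(h x, h y) \<in> r - Id" if "(x, y) \<in> r - Id" for x y
    using h_mono[of x y] that inj by (auto simp: Field_def dest: inj_onD)
  have "wf (r - Id)" using r by (simp add: well_order_on_def)
  then have no_descent: "(h x, x) \<notin> r - Id" for x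
  proof (induction x rule: wf_induct_rule)
    case (less x)
    then show ?case using h_lt by blast
  qed
  have "(a, a) \<in> r"
    using a(1) r by (auto simp: Field_def order_on_defs refl_on_def)
  from h_mono[OF this] have "(h a, a) \<in> r - Id"
    by (auto simp: underS_def)
  then show False using no_descent by blast
qed

definition restrict_barrier :: "nat set set \<Rightarrow> nat set \<Rightarrow> nat set set" where
  "restrict_barrier B X = {s \<in> B. s \<subseteq> X}"

lemma lex_rel_restrict_barrier_ordLeq:
  assumes "lex_rel B \<le>o \<alpha>"
  shows "lex_rel (restrict_barrier B X) \<le>o \<alpha>"
proof -
  have "lex_rel (restrict_barrier B X) = Restr (lex_rel B) {s. s \<subseteq> X}"
    by (auto simp: lex_rel_def restrict_barrier_def)
  \<comment> \<open>\<open>ordLeq\<close> relates only well-orders, so this comes with the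
    hypothesis.\<close>
  moreover have "Well_order (lex_rel B)" using assms ordLeq_Well_order_simp by blast
  ultimately show ?thesis using Restr_ordLeq assms ordLeq_transitive by metis
qed

section \<open>Members of a barrier at the head of infinite sets\<close>

lemma initial_segment_comparable:
  assumes "initial_segment s X" "initial_segment t X"
  shows "s \<subseteq> t \<or> t \<subseteq> s"
proof (rule ccontr)
  assume "\<not> ?thesis"
  then obtain x y where "x \<in> s" "x \<notin> t" "y \<in> t" "y \<notin> s" by blast
  with assms show False
    by (metis initial_segment_def linorder_neqE_nat subsetD)
qed

lemma barrier_empty_notin:
  assumes "barrier B"
  shows "{} \<notin> B"
proof
  assume "{} \<in> B"
  with assms have "B \<subseteq> {{}}" by (auto simp: barrier_def)
  with assms show False by (meson barrier_def finite.emptyI finite_insert finite_subset)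
qed

lemma infinite_Union_barrier:
  assumes "barrier B"
  shows "infinite (\<Union>B)"
  using assms finite_UnionD unfolding barrier_def by blast

text \<open>Existence is guaranteed for infinite \<open>X \<subseteq> \<Union>B\<close>, uniqueness
  by the incomparability of members. Maps on a barrier thus become functions of infinite
  sets.\<close>

definition front :: "nat set set \<Rightarrow> nat set \<Rightarrow> nat set" where
  "front B X = (THE s. s \<in> B \<and> initial_segment s X)"

lemma front_eq:
  assumes "barrier B" "s \<in> B" "initial_segment s X"
  shows "front B X = s"
  unfolding front_def
proof (rule the_equality)
  fix t assume "t \<in> B \<and> initial_segment t X"
  with assms show "t = s"
    using initial_segment_comparable[of s X t] by (auto simp: barrier_def)
qed (use assms in auto)

lemma front_props:
  assumes "barrier B" "X \<subseteq> \<Union>B" "infinite X"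
  shows "front B X \<in> B" "initial_segment (front B X) X" "front B X \<noteq> {}" "finite (front B X)"
proof -
  obtain s where "s \<in> B" "s \<noteq> {}" "finite s" "initial_segment s X"
    using assms unfolding barrier_def by meson
  then show "front B X \<in> B" "initial_segment (front B X) X" "front B X \<noteq> {}" "finite (front B X)"
    using front_eq[OF assms(1)] by auto
qed

text \<open>The witness for \<open>shift_rel\<close> is the second front with \<open>m\<close>
  inserted, again an initial segment of \<open>X\<close>. It strictly contains the first front,
  since otherwise the second would be a proper subset of the first.\<close>

lemma front_shift:
  assumes B: "barrier B" and X: "X \<subseteq> \<Union>B" "infinite X"
    and m: "m \<in> X" "\<And>x. x \<in> X \<Longrightarrow> m \<le> x"
  shows "shift_rel (front B X) (front B (X - {m}))"
proof -
  let ?s = "front B X" and ?t = "front B (X - {m})"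
  have s: "?s \<in> B" "initial_segment ?s X" "?s \<noteq> {}"
    using front_props[OF B X] by auto
  have t: "?t \<in> B" "initial_segment ?t (X - {m})" "finite ?t"
    using front_props[OF B, of "X - {m}"] X
    by (meson Diff_subset finite_Diff2 finite.emptyI finite_insert subset_trans)+
  have mt: "m \<notin> ?t" "\<And>x. x \<in> ?t \<Longrightarrow> m \<le> x"
    using t m by (auto simp: initial_segment_def)
  have r: "initial_segment (insert m ?t) X"
    unfolding initial_segment_def
  proof (intro conjI ballI impI)
    show "insert m ?t \<subseteq> X" using t m by (auto simp: initial_segment_def)
    fix x y assume "x \<in> insert m ?t" "y \<in> X" "y < x"
    then have "x \<in> ?t" using m(2)[of y] by auto
    then show "y \<in> insert m ?t"
      using t(2) \<open>y \<in> X\<close> \<open>y < x\<close> unfolding initial_segment_def by blast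
  qed
  have "m \<in> ?s"
  proof -
    obtain x where x: "x \<in> ?s" using s by auto
    then have "m \<le> x" using s m by (auto simp: initial_segment_def)
    then show ?thesis using x s(2) m(1) unfolding initial_segment_def by (metis le_neq_implies_less)
  qed
  have "\<not> insert m ?t \<subseteq> ?s"
  proof
    assume "insert m ?t \<subseteq> ?s"
    then have "?t \<subset> ?s" using mt by auto
    then show False using B s t by (auto simp: barrier_def)
  qed
  then have "?s \<subseteq> insert m ?t" "?s \<noteq> insert m ?t"
    using initial_segment_comparable[OF s(2) r] by auto
  moreover have "initial_segment ?s (insert m ?t)"
    unfolding initial_segment_def
  proof (intro conjI ballI impI)
    fix x y assume "x \<in> ?s" "y \<in> insert m ?t" "y < x"
    moreover from this have "y \<in> X" using r unfolding initial_segment_def by blast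
    ultimately show "y \<in> ?s" using s(2) unfolding initial_segment_def by blast
  qed fact
  moreover have "Min (insert m ?t) = m"
    using mt t by (intro Min_eqI) auto
  ultimately show ?thesis
    unfolding shift_rel_def using t mt by (intro exI[of _ "insert m ?t"]) auto
qed

lemma initial_segment_precedes:
  assumes "precedes s Y"
  shows "initial_segment s (s \<union> Y)"
  unfolding initial_segment_def
proof (intro conjI ballI impI)
  fix x y assume "x \<in> s" "y \<in> s \<union> Y" "y < x"
  then show "y \<in> s" using assms unfolding precedes_def by (meson UnE less_asym)
qed simp

lemma initial_segment_trans:
  assumes "initial_segment s t" "initial_segment t X"
  shows "initial_segment s X"
  unfolding initial_segment_def
proof (intro conjI ballI impI)
  show "s \<subseteq> X" using assms by (auto simp: initial_segment_def)
  fix x y assume "x \<in> s" "y \<in> X" "y < x"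
  moreover from this have "y \<in> t" using assms by (auto simp: initial_segment_def)
  ultimately show "y \<in> s" using assms(1) by (auto simp: initial_segment_def)
qed

text \<open>Converse of \<open>front_shift\<close>: append to a witness \<open>r\<close> all points
  of \<open>X\<close> beyond \<open>Max r\<close>.\<close>

lemma shift_rel_front:
  assumes B: "barrier B" and st: "s \<in> B" "t \<in> B" "shift_rel s t"
    and X: "s \<subseteq> X" "t \<subseteq> X" "X \<subseteq> \<Union>B" "infinite X"
  obtains Z where "Z \<subseteq> X" "infinite Z" "front B Z = s" "front B (Z - {Inf Z}) = t"
proof -
  obtain r where r: "finite r" "r \<noteq> {}" "initial_segment s r" "t = r - {Min r}"
    using st by (auto simp: shift_rel_def)
  have "s \<noteq> {}" using B st barrier_empty_notin by auto
  \<comment> \<open>This puts \<open>r\<close> inside \<open>s \<union> t\<close>, hence inside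
    \<open>X\<close>.\<close>
  then have "Min r \<in> s"
    using r unfolding initial_segment_def
    by (metis Min_in Min_le all_not_in_conv le_neq_implies_less subsetD)
  then have rX: "r \<subseteq> X" using r X by auto
  define Y where "Y = X \<inter> {Max r<..}"
  have Y: "precedes r Y" "infinite Y"
    using r(1) X infinite_nat_greater by (auto simp: Y_def precedes_def le_less_trans[OF Max_ge])
  let ?Z = "r \<union> Y"
  have "\<forall>z\<in>?Z. Min r \<le> z"
    using r(1) Y(1) Min_in[OF r(1,2)] unfolding precedes_def by (metis Min_le UnE less_imp_le)
  then have "Inf ?Z = Min r"
    using r by (intro cInf_eq_minimum) auto
  moreover have "?Z - {Min r} = t \<union> Y"
    using r(4) Y(1) Min_in[OF r(1,2)] unfolding precedes_def by blast
  moreover have "precedes t Y" using r Y by (auto simp: precedes_def)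
  ultimately have "front B (?Z - {Inf ?Z}) = t"
    using front_eq[OF B st(2)] initial_segment_precedes by metis
  moreover have "front B ?Z = s"
    using front_eq[OF B st(1)] initial_segment_precedes[OF Y(1)] initial_segment_trans r by blast
  ultimately show ?thesis
    using that[of ?Z] Y rX by (auto simp: Y_def)
qed

section \<open>Sub-barriers and their Ramsey property\<close>

lemma barrier_restrict_barrier:
  assumes B: "barrier B" and X: "X \<subseteq> \<Union>B" "infinite X"
  shows "barrier (restrict_barrier B X)"
proof -
  let ?B = "restrict_barrier B X"
  have fin: "\<forall>s\<in>?B. finite s" using B by (auto simp: barrier_def restrict_barrier_def)
  \<comment> \<open>For a bound \<open>k\<close> of \<open>\<Union>?B\<close>, the front of the part
    of \<open>X\<close> beyond \<open>k\<close> would be a nonempty member of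
    \<open>?B\<close>.\<close>
  have "infinite ?B"
  proof
    assume "finite ?B"
    then have "finite (\<Union>?B)" using fin by auto
    then obtain k where k: "\<And>x. x \<in> \<Union>?B \<Longrightarrow> x \<le> k"
      using finite_nat_set_iff_bounded_le by meson
    let ?Y = "X \<inter> {k<..}"
    have Y: "infinite ?Y" "?Y \<subseteq> \<Union>B" using infinite_nat_greater X by auto
    have "front B ?Y \<in> ?B" "front B ?Y \<subseteq> ?Y"
      using front_props[OF B Y(2,1)] by (auto simp: restrict_barrier_def initial_segment_def)
    moreover obtain x where "x \<in> front B ?Y" using front_props(3)[OF B Y(2,1)] by auto
    ultimately show False using k[of x] by fastforce
  qed
  moreover have "\<exists>s\<in>?B. s \<noteq> {} \<and> finite s \<and> initial_segment s Z"
    if Z: "Z \<subseteq> \<Union>?B" "infinite Z" for Z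
  proof -
    have "Z \<subseteq> \<Union>B" "Z \<subseteq> X" using Z by (auto simp: restrict_barrier_def)
    moreover note s = front_props[OF B \<open>Z \<subseteq> \<Union>B\<close> Z(2)]
    moreover have "front B Z \<subseteq> Z" using s(2) by (simp add: initial_segment_def)
    ultimately have "front B Z \<in> ?B" by (auto simp: restrict_barrier_def)
    with s show ?thesis by blast
  qed
  ultimately show ?thesis
    using B fin unfolding barrier_def by (simp add: restrict_barrier_def)
qed

text \<open>Colour an infinite \<open>Z\<close> by \<open>R\<close> at the fronts of
  \<open>Z\<close> and of \<open>Z\<close> without its least element. This is a clopen colouring,
  and by \<open>shift_rel_front\<close> its values on subsets of a homogeneous \<open>X\<close>
  cover all pairs in the sub-barrier.\<close>

theorem barrier_pair_Ramsey:
  fixes R :: "nat set \<Rightarrow> nat set \<Rightarrow> bool"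
  assumes B: "barrier B"
  obtains X c where "barrier (restrict_barrier B X)"
    "\<And>s t. s \<in> restrict_barrier B X \<Longrightarrow> t \<in> restrict_barrier B X \<Longrightarrow> shift_rel s t \<Longrightarrow> R s t = c"
proof -
  define C where "C Z = R (front B Z) (front B (Z - {Inf Z}))" for Z
  have clopen: "\<exists>n. \<forall>Z'. Z' \<subseteq> \<Union>B \<and> infinite Z' \<and> Z' \<inter> {..n} = Z \<inter> {..n} \<longrightarrow> C Z' = C Z"
    if Z: "Z \<subseteq> \<Union>B" "infinite Z" for Z
  proof -
    let ?s = "front B Z" and ?t = "front B (Z - {Inf Z})"
    have Z1: "Z - {Inf Z} \<subseteq> \<Union>B" "infinite (Z - {Inf Z})" using Z by auto
    note s = front_props[OF B Z] and t = front_props[OF B Z1]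
    have Inf: "Inf Z \<in> Z" using Z by (metis Inf_nat_def1 finite.emptyI)
    \<comment> \<open>Agreement up to this \<open>n\<close> preserves the least element and both
      fronts, hence the colour.\<close>
    obtain n where n: "\<And>x. x \<in> insert (Inf Z) (?s \<union> ?t) \<Longrightarrow> x \<le> n"
      using s t finite_nat_set_iff_bounded_le[of "insert (Inf Z) (?s \<union> ?t)"] by auto
    have "C Z' = C Z" if Z': "Z' \<subseteq> \<Union>B" "infinite Z'" "Z' \<inter> {..n} = Z \<inter> {..n}" for Z'
    proof -
      have iff: "x \<in> Z' \<longleftrightarrow> x \<in> Z" if "x \<le> n" for x using Z'(3) that by blast
      have Inf_n: "Inf Z \<le> n" using n by auto
      have Inf': "Inf Z' = Inf Z"
      proof (rule cInf_eq_minimum)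
        show "Inf Z \<in> Z'" using iff[OF Inf_n] Inf by simp
        fix x assume "x \<in> Z'"
        then show "Inf Z \<le> x"
          using iff[of x] Inf_n by (metis nle_le order_trans wellorder_Inf_le1)
      qed
      have agree: "initial_segment u W'"
        if "initial_segment u W" "\<And>x. x \<in> u \<Longrightarrow> x \<le> n" "\<And>x. x \<le> n \<Longrightarrow> x \<in> W' \<longleftrightarrow> x \<in> W"
        for u W W'
        using that unfolding initial_segment_def
        by (metis less_imp_le order_trans subset_iff)
      have s': "initial_segment ?s Z'"
        by (rule agree[OF s(2)]) (use n iff in auto)
      have t': "initial_segment ?t (Z' - {Inf Z})"
        by (rule agree[OF t(2)]) (use n iff in auto)
      show ?thesis
        unfolding C_def Inf' front_eq[OF B s(1) s'] front_eq[OF B t(1) t'] by (rule refl)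
    qed
    then show ?thesis by blast
  qed
  obtain X c where X: "X \<subseteq> \<Union>B" "infinite X" "\<And>Z. Z \<subseteq> X \<Longrightarrow> infinite Z \<Longrightarrow> C Z = c"
    by (rule clopen_Ramsey[OF infinite_Union_barrier[OF B], of C]) (use clopen in auto)
  have "R s t = c" if st: "s \<in> restrict_barrier B X" "t \<in> restrict_barrier B X" "shift_rel s t" for s t
  proof -
    obtain Z where "Z \<subseteq> X" "infinite Z" "front B Z = s" "front B (Z - {Inf Z}) = t"
      by (rule shift_rel_front[OF B _ _ st(3) _ _ X(1,2)])
        (use st in \<open>auto simp: restrict_barrier_def\<close>)
    with X(3) show ?thesis by (auto simp: C_def)
  qed
  with barrier_restrict_barrier[OF B X(1,2)] that show ?thesis by blast
qed

section \<open>Two-element maximal antichains\<close>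

text \<open>For the last claim: an incomparable \<open>z\<close> would enlarge the antichain, and
  reflexivity excludes that \<open>z\<close> is \<open>x\<close> or \<open>y\<close>. Maximality is
  used below in this form.\<close>

lemma AM2_pair:
  assumes po: "partial_order_on P r" and A: "{x, y} \<in> AM2 P r"
  shows "x \<in> P" "y \<in> P" "(x, y) \<notin> r" "(y, x) \<notin> r"
    "\<And>z. z \<in> P \<Longrightarrow> (x, z) \<in> r \<or> (z, x) \<in> r \<or> (y, z) \<in> r \<or> (z, y) \<in> r"
proof -
  have max: "maximal_antichain P r {x, y}" and "card {x, y} = 2"
    using A by (auto simp: AM2_def)
  then have "x \<noteq> y" by auto
  then show P: "x \<in> P" "y \<in> P" "(x, y) \<notin> r" "(y, x) \<notin> r"
    using max by (auto simp: maximal_antichain_def antichain_def)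
  fix z assume z: "z \<in> P"
  show "(x, z) \<in> r \<or> (z, x) \<in> r \<or> (y, z) \<in> r \<or> (z, y) \<in> r"
  proof (rule ccontr)
    assume no: "\<not> ?thesis"
    then have "antichain P r (insert z {x, y})"
      using P z by (auto simp: antichain_def)
    then have "insert z {x, y} = {x, y}"
      using max unfolding maximal_antichain_def by blast
    then have "z = x \<or> z = y" by blast
    with no z po show False by (auto simp: order_on_defs refl_on_def)
  qed
qed

lemma AM2_obtain:
  assumes "A \<in> AM2 P r"
  obtains x y where "A = {x, y}"
  using assms by (auto simp: AM2_def card_2_iff)

section \<open>The two implications\<close>

lemma alpha_bqo_AM2_if_alpha_bqo_Union:
  assumes bqo: "alpha_bqo \<alpha> (\<Union>(AM2 P r)) (UAM2_rel P r)"
  shows "alpha_bqo \<alpha> (AM2 P r) (AM2_rel P r)"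
  unfolding alpha_bqo_def
proof (intro allI impI, elim conjE)
  fix B F
  assume B: "barrier B" "lex_rel B \<le>o \<alpha>" and F: "F ` B \<subseteq> AM2 P r"
  have "\<forall>s\<in>B. \<exists>x y. F s = {x, y}" using F AM2_obtain by (metis image_subset_iff)
  then obtain f g where fg: "\<And>s. s \<in> B \<Longrightarrow> F s = {f s, g s}" by metis
  obtain X c where X: "barrier (restrict_barrier B X)"
    and c: "\<And>s t. s \<in> restrict_barrier B X \<Longrightarrow> t \<in> restrict_barrier B X \<Longrightarrow> shift_rel s t \<Longrightarrow>
      ((f s, f t) \<in> r) = c"
    using barrier_pair_Ramsey[OF B(1), of "\<lambda>s t. (f s, f t) \<in> r"] by blast
  let ?B = "restrict_barrier B X"
  have sub: "?B \<subseteq> B" by (auto simp: restrict_barrier_def)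
  \<comment> \<open>Stated for any selection \<open>h\<close> from \<open>F\<close>, to serve both
    coordinates.\<close>
  have good: "\<exists>s\<in>?B. \<exists>t\<in>?B. shift_rel s t \<and> (h s, h t) \<in> r" if "\<And>s. s \<in> B \<Longrightarrow> h s \<in> F s" for h
  proof -
    have "h ` ?B \<subseteq> \<Union>(AM2 P r)" using that F sub by blast
    then have "good_map ?B (UAM2_rel P r) h"
      using bqo X lex_rel_restrict_barrier_ordLeq[OF B(2)] unfolding alpha_bqo_def by blast
    then show ?thesis by (auto simp: good_map_def UAM2_rel_def)
  qed
  \<comment> \<open>A good pair for \<open>f\<close> forces the colour \<open>True\<close>, so a
    good pair for \<open>g\<close> is good in both coordinates.\<close>
  from good[of f] fg c have c by auto
  obtain s t where st: "s \<in> ?B" "t \<in> ?B" "shift_rel s t" "(g s, g t) \<in> r"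
    using good[of g] fg by auto
  moreover have "(f s, f t) \<in> r" using c st \<open>c\<close> by auto
  ultimately have "(F s, F t) \<in> AM2_rel P r"
    using fg F sub by (auto simp: AM2_rel_def image_subset_iff subset_iff)
  then show "good_map B (AM2_rel P r) F"
    using st sub unfolding good_map_def by blast
qed

lemma good_of_dominating_AM2:
  assumes po: "partial_order_on P r" and B: "barrier B"
    and AM: "\<And>s. s \<in> B \<Longrightarrow> {f s, g s} \<in> AM2 P r"
    and dom: "\<And>s t. s \<in> B \<Longrightarrow> t \<in> B \<Longrightarrow> shift_rel s t \<Longrightarrow>
      ({f s, g s}, {f t, g t}) \<in> AM2_rel P r"
  shows "\<exists>s\<in>B. \<exists>t\<in>B. shift_rel s t \<and> (f s, f t) \<in> r"
proof (rule ccontr)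
  assume "\<not> ?thesis"
  then have bad: "\<And>s t. s \<in> B \<Longrightarrow> t \<in> B \<Longrightarrow> shift_rel s t \<Longrightarrow> (f s, f t) \<notin> r" by blast
  have tr: "\<And>x y z. (x, y) \<in> r \<Longrightarrow> (y, z) \<in> r \<Longrightarrow> (x, z) \<in> r"
    using po transD[of r] unfolding order_on_defs by simp
  have refl: "\<And>x. x \<in> P \<Longrightarrow> (x, x) \<in> r"
    using po by (auto simp: order_on_defs refl_on_def)
  note AMs = AM2_pair[OF po AM]
  let ?U = "\<Union>B" and ?b = "front B"
  \<comment> \<open>Badness and domination give \<open>f s \<le> g t\<close>. If \<open>f t\<close>
    were below \<open>f s\<close>, or below \<open>g s\<close> with \<open>g s \<le> g t\<close>, it
    would be below \<open>g t\<close>; maximality at \<open>s\<close> leaves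
    \<open>g s \<le> f t\<close>.\<close>
  have cross: "(f s, g t) \<in> r \<and> (g s, f t) \<in> r" if st: "s \<in> B" "t \<in> B" "shift_rel s t" for s t
  proof -
    have d: "(f s, f t) \<in> r \<or> (f s, g t) \<in> r" "(g s, f t) \<in> r \<or> (g s, g t) \<in> r"
      using dom[OF st] by (auto simp: AM2_rel_def)
    then have fg: "(f s, g t) \<in> r" using bad[OF st] by auto
    then have "(f t, f s) \<notin> r" using tr AMs(3)[OF st(2)] by blast
    then have "(g s, f t) \<in> r \<or> (f t, g s) \<in> r"
      using AMs(5)[OF st(1) AMs(1)[OF st(2)]] bad[OF st] by blast
    then show ?thesis using fg d(2) tr AMs(3)[OF st(2)] by blast
  qed
  have inU: "s \<subseteq> ?U" if "s \<in> B" for s using that by auto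
  have step: "shift_rel (?b (a \<union> Y)) (?b (a - {Min a} \<union> Y))"
    if "finite a" "a \<noteq> {}" "a \<subseteq> ?U" "Y \<subseteq> ?U" "infinite Y" "precedes a Y" for a Y
  proof -
    have "(a \<union> Y) - {Min a} = a - {Min a} \<union> Y"
      using that(6) Min_in[OF that(1,2)] unfolding precedes_def by blast
    moreover have "Min a \<le> x" if "x \<in> a \<union> Y" for x
      using that \<open>finite a\<close> \<open>precedes a Y\<close> Min_in[OF \<open>finite a\<close> \<open>a \<noteq> {}\<close>]
      unfolding precedes_def by (metis Min_le UnE less_imp_le)
    ultimately show ?thesis
      using front_shift[OF B, of "a \<union> Y" "Min a"] that by auto
  qed
  have bB: "?b (a \<union> Y) \<in> B" if "a \<subseteq> ?U" "Y \<subseteq> ?U" "infinite Y" for a Y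
    using front_props(1)[OF B, of "a \<union> Y"] that by auto
  \<comment> \<open>Deleting the points of \<open>a\<close> one by one is a path of
    \<open>card a\<close> shifts; each swaps \<open>f\<close> and \<open>g\<close>, so only the
    parity matters.\<close>
  have path: "(f (?b (a \<union> Y)), (if even (card a) then f else g) (?b Y)) \<in> r \<and>
      (g (?b (a \<union> Y)), (if even (card a) then g else f) (?b Y)) \<in> r"
    if "finite a" "a \<subseteq> ?U" "precedes a Y" and Y: "Y \<subseteq> ?U" "infinite Y" for a Y
    using that(1-3)
  proof (induction "card a" arbitrary: a)
    case 0
    then show ?case using refl AMs(1,2) bB[of "{}" Y] Y by simp
  next
    case (Suc k)
    then have ne: "a \<noteq> {}" by auto
    let ?a = "a - {Min a}"
    have k: "k = card ?a" using Suc ne by simp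
    have IH: "(f (?b (?a \<union> Y)), (if even k then f else g) (?b Y)) \<in> r \<and>
      (g (?b (?a \<union> Y)), (if even k then g else f) (?b Y)) \<in> r"
      unfolding k
    proof (rule Suc.hyps(1)[OF k])
      show "finite ?a" "?a \<subseteq> ?U" "precedes ?a Y"
        using Suc.prems unfolding precedes_def by blast+
    qed
    have "(f (?b (a \<union> Y)), g (?b (?a \<union> Y))) \<in> r \<and> (g (?b (a \<union> Y)), f (?b (?a \<union> Y))) \<in> r"
    proof (rule cross)
      show "?b (a \<union> Y) \<in> B" "?b (?a \<union> Y) \<in> B"
        by (rule bB[OF _ Y], use Suc.prems(2) in blast)+
      show "shift_rel (?b (a \<union> Y)) (?b (?a \<union> Y))"
        by (rule step[OF Suc.prems(1) ne Suc.prems(2) Y Suc.prems(3)])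
    qed
    then have "(f (?b (a \<union> Y)), (if even k then g else f) (?b Y)) \<in> r \<and>
        (g (?b (a \<union> Y)), (if even k then f else g) (?b Y)) \<in> r"
      using IH tr[of "f (?b (a \<union> Y))" "g (?b (?a \<union> Y))"]
        tr[of "g (?b (a \<union> Y))" "f (?b (?a \<union> Y))"] by simp
    moreover have "even (card a) \<longleftrightarrow> odd k" using Suc.hyps(2) by (metis even_Suc)
    ultimately show ?case by (cases "even k") simp_all
  qed
  have far: "\<exists>N. \<forall>Y. Y \<subseteq> ?U \<inter> {N<..} \<and> infinite Y \<longrightarrow>
      {f t, g t} \<times> {f (?b Y), g (?b Y)} \<subseteq> r" if t: "t \<in> B" for t
  proof -
    have fin: "finite t" using B t by (auto simp: barrier_def)
    then obtain k where k: "\<And>x. x \<in> t \<Longrightarrow> x \<le> k"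
      using finite_nat_set_iff_bounded_le by auto
    obtain x where x: "x \<in> ?U" "k < x"
      using infinite_nat_greater[OF infinite_Union_barrier[OF B], of k]
      by (metis Int_iff all_not_in_conv finite.emptyI greaterThan_iff)
    \<comment> \<open>Both \<open>t \<union> Y\<close> and \<open>insert x t \<union> Y\<close> have
      front \<open>t\<close>, and their paths to the front of \<open>Y\<close> have opposite
      parities; together they give all four comparisons.\<close>
    have "{f t, g t} \<times> {f (?b Y), g (?b Y)} \<subseteq> r" if Y: "Y \<subseteq> ?U \<inter> {x<..}" "infinite Y" for Y
    proof -
      have ab: "precedes t Y" "precedes (insert x t) Y" "precedes t (insert x Y)"
        using x Y(1) by (auto simp: precedes_def dest!: k)
      have "?b (t \<union> Y) = t" "?b (insert x t \<union> Y) = t"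
        using front_eq[OF B t] initial_segment_precedes[OF ab(1)] initial_segment_precedes[OF ab(3)]
        by auto
      moreover have "x \<notin> t" using k[of x] x(2) by auto
      then have "card (insert x t) = Suc (card t)" using fin by simp
      moreover have YU: "Y \<subseteq> ?U" and xU: "insert x t \<subseteq> ?U" using Y(1) x(1) inU[OF t] by auto
      ultimately show ?thesis
        using path[OF fin inU[OF t] ab(1) YU Y(2)] path[OF _ xU ab(2) YU Y(2)] fin
        by (cases "even (card t)") simp_all
    qed
    then show ?thesis by blast
  qed
  \<comment> \<open>Backward transfer of lower bounds: each point prepended by \<open>a\<close> is
    one shift back from a far front. The finite set \<open>a\<close> is independent of
    \<open>t\<close>.\<close>
  have "\<exists>N. \<forall>Y. Y \<subseteq> ?U \<inter> {N<..} \<and> infinite Y \<longrightarrow>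
      (f t, f (?b (a \<union> Y))) \<in> r \<and> (g t, f (?b (a \<union> Y))) \<in> r"
    if "t \<in> B" "finite a" "a \<subseteq> ?U" for t a
    using that
  proof (induction "card a" arbitrary: a t)
    case 0
    then show ?case using far[of t] by auto
  next
    case (Suc k)
    then have ne: "a \<noteq> {}" by auto
    let ?a = "a - {Min a}"
    have k: "k = card ?a" using Suc ne by simp
    obtain N1 where N1: "\<forall>Y. Y \<subseteq> ?U \<inter> {N1<..} \<and> infinite Y \<longrightarrow>
        {f t, g t} \<times> {f (?b Y), g (?b Y)} \<subseteq> r"
      using far[OF Suc.prems(1)] by (rule exE)
    have inf: "infinite (?U \<inter> {N1<..})"
      by (rule infinite_nat_greater[OF infinite_Union_barrier[OF B]])
    \<comment> \<open>An intermediate member above both elements at \<open>t\<close>: being above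
      either of \<open>f t'\<close>, \<open>g t'\<close> is then enough.\<close>
    define t' where "t' = ?b (?U \<inter> {N1<..})"
    have t': "t' \<in> B" using bB[of "{}"] inf by (simp add: t'_def)
    have tt': "{f t, g t} \<times> {f t', g t'} \<subseteq> r" using N1 inf by (simp add: t'_def)
    have "finite ?a" "?a \<subseteq> ?U" using Suc.prems by blast+
    from Suc.hyps(1)[OF k t' this] obtain N2 where N2: "\<forall>Y. Y \<subseteq> ?U \<inter> {N2<..} \<and> infinite Y \<longrightarrow>
        (f t', f (?b (?a \<union> Y))) \<in> r \<and> (g t', f (?b (?a \<union> Y))) \<in> r"
      by (rule exE)
    have "(f t, f (?b (a \<union> Y))) \<in> r \<and> (g t, f (?b (a \<union> Y))) \<in> r"
      if Y: "Y \<subseteq> ?U \<inter> {max N2 (Max a)<..}" "infinite Y" for Y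
    proof -
      have YU: "Y \<subseteq> ?U" and YN: "Y \<subseteq> ?U \<inter> {N2<..}" using Y(1) by auto
      have "precedes a Y"
        using Y Max_ge[OF Suc.prems(2)] by (force simp: precedes_def)
      let ?v = "?b (a \<union> Y)" and ?w = "?b (?a \<union> Y)"
      have v: "?v \<in> B" and w: "?w \<in> B"
        by (rule bB[OF _ YU Y(2)], use Suc.prems(3) in blast)+
      have "shift_rel ?v ?w"
        by (rule step[OF Suc.prems(2) ne Suc.prems(3) YU Y(2) \<open>precedes a Y\<close>])
      then have "(f ?v, f ?w) \<notin> r" using bad v w by blast
      moreover have "(f t', f ?w) \<in> r" "(g t', f ?w) \<in> r" using N2 YN Y(2) by simp_all
      \<comment> \<open>Either comparison would yield \<open>f ?v \<le> f ?w\<close>, against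
        badness; so maximality at \<open>t'\<close> places \<open>f ?v\<close> above one of its
        elements.\<close>
      ultimately have "(f ?v, f t') \<notin> r" "(f ?v, g t') \<notin> r" using tr by blast+
      then have "(f t', f ?v) \<in> r \<or> (g t', f ?v) \<in> r"
        using AMs(5)[OF t' AMs(1)[OF v]] by blast
      moreover have "(f t, f t') \<in> r" "(f t, g t') \<in> r" "(g t, f t') \<in> r" "(g t, g t') \<in> r"
        using tt' by auto
      ultimately show ?thesis using tr by blast
    qed
    then show ?case by (intro exI[of _ "max N2 (Max a)"]) simp
  qed
  note key = this
  obtain s where s: "s \<in> B" using B by (metis barrier_def ex_in_conv finite.emptyI)
  have fin: "finite s" and ne: "s \<noteq> {}"
    using B s barrier_empty_notin by (auto simp: barrier_def)
  \<comment> \<open>With this \<open>?a\<close>, the front of \<open>?a \<union> Y\<close> is a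
    shift successor of \<open>s\<close>, so the transferred bound contradicts badness.\<close>
  let ?a = "s - {Min s}"
  have "finite ?a" "?a \<subseteq> ?U" using fin inU[OF s] by blast+
  from key[OF s this] obtain N where N: "\<forall>Y. Y \<subseteq> ?U \<inter> {N<..} \<and> infinite Y \<longrightarrow>
      (f s, f (?b (?a \<union> Y))) \<in> r \<and> (g s, f (?b (?a \<union> Y))) \<in> r"
    by (rule exE)
  define Y where "Y = ?U \<inter> {max N (Max s)<..}"
  have Y: "Y \<subseteq> ?U \<inter> {N<..}" "Y \<subseteq> ?U" "infinite Y" "precedes s Y"
    using infinite_nat_greater infinite_Union_barrier[OF B]
    by (auto simp: Y_def precedes_def dest: Max_ge[OF fin])
  have "?b (s \<union> Y) = s" using front_eq[OF B s] initial_segment_precedes[OF Y(4)] by auto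
  then have "shift_rel s (?b (?a \<union> Y))" using step[OF fin ne inU[OF s] Y(2-4)] by simp
  moreover have "?b (?a \<union> Y) \<in> B" by (rule bB[OF _ Y(2,3)]) (use inU[OF s] in blast)
  moreover have "(f s, f (?b (?a \<union> Y))) \<in> r" using N Y(1,3) by simp
  ultimately show False using bad[OF s] by simp
qed

text \<open>Complete each value to a two-element maximal antichain and homogenise domination;
  \<open>good_of_dominating_AM2\<close> does the rest.\<close>

lemma alpha_bqo_Union_if_alpha_bqo_AM2:
  assumes po: "partial_order_on P r" and bqo: "alpha_bqo \<alpha> (AM2 P r) (AM2_rel P r)"
  shows "alpha_bqo \<alpha> (\<Union>(AM2 P r)) (UAM2_rel P r)"
  unfolding alpha_bqo_def
proof (intro allI impI, elim conjE)
  fix B f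
  assume B: "barrier B" "lex_rel B \<le>o \<alpha>" and f: "f ` B \<subseteq> \<Union>(AM2 P r)"
  have "\<forall>s\<in>B. \<exists>y. {f s, y} \<in> AM2 P r"
  proof
    fix s assume "s \<in> B"
    then obtain A where A: "A \<in> AM2 P r" "f s \<in> A" using f by blast
    from A(1) obtain x y where "A = {x, y}" by (rule AM2_obtain)
    with A show "\<exists>y. {f s, y} \<in> AM2 P r" by (metis insert_commute insertE singletonD)
  qed
  then obtain g where g: "\<And>s. s \<in> B \<Longrightarrow> {f s, g s} \<in> AM2 P r" by metis
  let ?F = "\<lambda>s. {f s, g s}"
  obtain X c where X: "barrier (restrict_barrier B X)"
    and c: "\<And>s t. s \<in> restrict_barrier B X \<Longrightarrow> t \<in> restrict_barrier B X \<Longrightarrow> shift_rel s t \<Longrightarrow>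
      ((?F s, ?F t) \<in> AM2_rel P r) = c"
    using barrier_pair_Ramsey[OF B(1), of "\<lambda>s t. (?F s, ?F t) \<in> AM2_rel P r"] by blast
  let ?B = "restrict_barrier B X"
  have sub: "?B \<subseteq> B" by (auto simp: restrict_barrier_def)
  have "?F ` ?B \<subseteq> AM2 P r" using g sub by blast
  then have "good_map ?B (AM2_rel P r) ?F"
    using bqo X lex_rel_restrict_barrier_ordLeq[OF B(2)] unfolding alpha_bqo_def by blast
  \<comment> \<open>One dominated pair on the sub-barrier fixes the colour, so all its shift pairs
    are dominated.\<close>
  then have c using c by (auto simp: good_map_def)
  have "\<exists>s\<in>?B. \<exists>t\<in>?B. shift_rel s t \<and> (f s, f t) \<in> r"
    by (rule good_of_dominating_AM2[OF po X, of f g]) (use g sub c \<open>c\<close> in auto)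
  then show "good_map B (UAM2_rel P r) f"
  proof (elim bexE conjE)
    fix s t assume st: "s \<in> ?B" "t \<in> ?B" "shift_rel s t" "(f s, f t) \<in> r"
    then have "s \<in> B" "t \<in> B" using sub by auto
    moreover from this have "(f s, f t) \<in> UAM2_rel P r"
      using f st(4) unfolding UAM2_rel_def by blast
    ultimately show ?thesis using st(3) unfolding good_map_def by blast
  qed
qed

theorem theorem6p3:
  fixes P :: "'a set" and r :: "'a rel" and \<alpha> :: "'b rel"
  assumes "partial_order_on P r"
    and "\<forall>A. antichain P r A \<longrightarrow> finite A"
    and "Well_order \<alpha>" and "countable (Field \<alpha>)"
  shows "alpha_bqo \<alpha> (AM2 P r) (AM2_rel P r) \<longleftrightarrow>
         alpha_bqo \<alpha> (\<Union>(AM2 P r)) (UAM2_rel P r)"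
  using alpha_bqo_AM2_if_alpha_bqo_Union alpha_bqo_Union_if_alpha_bqo_AM2[OF assms(1)] by blast

end
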